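(* Let $0\neq h\in\mathbb{F}[x]$ and let $u_1,\dots,u_\ell$ be the distinct monic irreducible factors of $h$ in $\mathbb{F}[x]$ that are not central in $A_h$. Then an element $v\in A_h$ is normal (i.e. $vA_h=A_hv$) if and only if $v=u_1^{\beta_1}\cdots u_\ell^{\beta_\ell}z$ for some integers $\beta_i\ge0$ and some $z$ in the center $Z(A_h)$. If $\mathrm{char}(\mathbb{F})=p>0$, the exponents may moreover be chosen with $0\le\beta_i<p$ for all $i$.
   Context: $\mathbb{F}$ is an arbitrary field. For $h\in\mathbb{F}[x]$, $A_h$ is the unital associative $\mathbb{F}$-algebra generated by $x,\hat y$ with defining relation $\hat yx-x\hat y=h$; $\mathbb{F}[x]$ is a subalgebra of $A_h$. An irreducible factor $u$ of $h$ is central in $A_h$ iff $u'=0$. *)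

theory Defs
  imports "HOL-Computational_Algebra.Polynomial"
begin

text \<open>Concrete model of A_h = F<x, y | y x - x y = h>.
  By the PBW-type normal form, every element of A_h is uniquely
  sum_i f_i y^i with f_i in F[x]; we represent it by the polynomial
  in y with coefficients in F[x], i.e. a term of type 'a poly poly
  (coefficient i is f_i).  The relation y f = f y + h f' extends to
  y^i f = sum_k (i choose k) D^k(f) y^(i-k) with D(f) = h * f'.\<close>

definition Dh :: "'a::field poly \<Rightarrow> 'a poly \<Rightarrow> 'a poly" where
  "Dh h f = h * pderiv f"

definition ypow_mult :: "'a::field poly \<Rightarrow> nat \<Rightarrow> 'a poly \<Rightarrow> 'a poly poly" where
  "ypow_mult h i f =
     (\<Sum>k\<le>i. monom (smult (of_nat (i choose k)) ((Dh h ^^ k) f)) (i - k))"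

text \<open>Multiplication of A_h:
  (sum_i f_i y^i)(sum_j g_j y^j) = sum_{i,j} f_i (y^i g_j) y^j\<close>
definition Amult :: "'a::field poly \<Rightarrow> 'a poly poly \<Rightarrow> 'a poly poly \<Rightarrow> 'a poly poly" where
  "Amult h P Q =
     (\<Sum>i\<le>degree P. \<Sum>j\<le>degree Q.
        smult (coeff P i) (ypow_mult h i (coeff Q j)) * monom 1 j)"

definition Aemb :: "'a::field poly \<Rightarrow> 'a poly poly" where
  "Aemb f = [:f:]"

definition Acenter :: "'a::field poly \<Rightarrow> 'a poly poly set" where
  "Acenter h = {z. \<forall>a. Amult h z a = Amult h a z}"

definition Anormal :: "'a::field poly \<Rightarrow> 'a poly poly \<Rightarrow> bool" where
  "Anormal h v \<longleftrightarrow> {Amult h v a | a. True} = {Amult h a v | a. True}"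

definition noncentral_factors :: "'a::field poly \<Rightarrow> 'a poly set" where
  "noncentral_factors h =
     {u. irreducible u \<and> lead_coeff u = 1 \<and> u dvd h \<and> Aemb u \<notin> Acenter h}"

end

theory Submission
  imports Defs "HOL-Computational_Algebra.Euclidean_Algorithm" "HOL-Number_Theory.Cong"
begin

text \<open>
  Backward direction: if \<open>f \<bar> D\<^sub>h f\<close>, which holds for every product of divisors of \<open>h\<close>, then
  \<open>f\<close> can be moved past any element, so \<open>f z\<close> is normal for central \<open>z\<close>.

  Forward direction: a normal \<open>v\<close> commutes with \<open>F[x]\<close> and satisfies \<open>v y = (y + t) v\<close>, so each
  coefficient \<open>g\<close> of \<open>v\<close> satisfies \<open>h g' = -t g\<close>. Comparing multiplicities of irreducible
  factors in such solutions shows that \<open>f = \<Prod> u\<^bsup>\<beta>\<^sub>u\<^esup>\<close>, with \<open>u\<close> ranging over the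
  noncentral factors of \<open>h\<close> and \<open>\<beta>\<^sub>u\<close> a multiplicity reduced modulo the characteristic,
  divides every coefficient with quotients of zero derivative; the quotient \<open>z\<close> is central
  and \<open>v = f z\<close>.
\<close>

section \<open>The algebra \<open>A\<^sub>h\<close> on normal forms\<close>

lemma Dh_0 [simp]: "Dh h 0 = 0"
  by (simp add: Dh_def)

lemma Dh_add: "Dh h (f + g) = Dh h f + Dh h g"
  by (simp add: Dh_def pderiv_add algebra_simps)

lemma Dh_mult: "Dh h (f * g) = Dh h f * g + f * Dh h g"
  by (simp add: Dh_def pderiv_mult algebra_simps)

lemma Dh_const [simp]: "Dh h [:c:] = 0"
  by (simp add: Dh_def)

lemma Dh_smult: "Dh h (smult a f) = smult a (Dh h f)"
  by (simp add: Dh_def pderiv_smult)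

lemma Dh_funpow_smult: "(Dh h ^^ k) (smult a f) = smult a ((Dh h ^^ k) f)"
  by (induction k) (auto simp: Dh_smult)

text \<open>On normal forms, \<open>y \<cdot> \<Sum>\<^sub>j f\<^sub>j y\<^sup>j = \<Sum>\<^sub>j (f\<^sub>j y + D\<^sub>h f\<^sub>j) y\<^sup>j\<close>; all
  structure of \<open>A\<^sub>h\<close> is derived from this operator.\<close>

definition ymul :: "'a::field poly \<Rightarrow> 'a poly poly \<Rightarrow> 'a poly poly" where
  "ymul h Q = pCons 0 Q + map_poly (Dh h) Q"

lemma coeff_ymul: "coeff (ymul h Q) n = (if n = 0 then 0 else coeff Q (n - 1)) + Dh h (coeff Q n)"
  by (cases n) (auto simp: ymul_def coeff_map_poly)

lemma ymul_add: "ymul h (P + Q) = ymul h P + ymul h Q"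
  by (rule poly_eqI) (simp add: coeff_ymul Dh_add)

lemma ymul_0 [simp]: "ymul h 0 = 0"
  by (rule poly_eqI) (simp add: coeff_ymul)

lemma ymul_sum: "ymul h (\<Sum>i\<in>A. f i) = (\<Sum>i\<in>A. ymul h (f i))"
  by (induction A rule: infinite_finite_induct) (auto simp: ymul_add)

lemma ymul_smult: "ymul h (smult c Q) = smult c (ymul h Q) + smult (Dh h c) Q"
  by (rule poly_eqI) (simp add: coeff_ymul Dh_mult algebra_simps)

lemma ymul_monom: "ymul h (monom p i) = monom p (Suc i) + monom (Dh h p) i"
  by (rule poly_eqI) (auto simp: coeff_ymul coeff_monom)

lemma ymul_monom_mult: "ymul h (monom 1 j * Q) = monom 1 j * ymul h Q"
  by (rule poly_eqI) (auto simp: coeff_ymul coeff_monom_mult)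

lemma ymul_funpow_add: "(ymul h ^^ i) (P + Q) = (ymul h ^^ i) P + (ymul h ^^ i) Q"
  by (induction i) (auto simp: ymul_add)

lemma ymul_funpow_0 [simp]: "(ymul h ^^ i) 0 = 0"
  by (induction i) auto

lemma ymul_funpow_sum: "(ymul h ^^ i) (\<Sum>j\<in>A. f j) = (\<Sum>j\<in>A. (ymul h ^^ i) (f j))"
  by (induction A rule: infinite_finite_induct) (auto simp: ymul_funpow_add)

lemma ymul_funpow_monom_mult: "(ymul h ^^ i) (monom 1 j * Q) = monom 1 j * (ymul h ^^ i) Q"
  by (induction i) (auto simp: ymul_monom_mult)

lemma ymul_funpow_monom_const: "(ymul h ^^ i) (monom [:c:] k) = monom [:c:] (i + k)"
  by (induction i) (auto simp: ymul_monom)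

lemma coeff_ymul_funpow_const:
  "coeff ((ymul h ^^ i) [:f:]) m =
     (if m \<le> i then smult (of_nat (i choose m)) ((Dh h ^^ (i - m)) f) else 0)"
proof (induction i arbitrary: m)
  case 0
  then show ?case by (cases m) auto
next
  case (Suc i)
  have step: "(ymul h ^^ Suc i) [:f:] = ymul h ((ymul h ^^ i) [:f:])" by simp
  show ?case
  proof (cases m)
    case 0
    then show ?thesis unfolding step coeff_ymul Suc.IH by (simp add: Dh_smult)
  next
    case (Suc m')
    show ?thesis
    proof (cases "m' < i")
      case True
      then have "Suc i - Suc m' = Suc (i - Suc m')" "i - m' = Suc (i - Suc m')" by simp_all
      then show ?thesis unfolding step coeff_ymul Suc.IH using True \<open>m = Suc m'\<close>
        by (simp add: Dh_smult Dh_funpow_smult smult_add_left[symmetric] del: smult_add_left)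
    next
      case False
      then show ?thesis unfolding step coeff_ymul Suc.IH using \<open>m = Suc m'\<close>
        by (auto simp: Dh_smult)
    qed
  qed
qed

lemma coeff_ypow_mult:
  "coeff (ypow_mult h i f) m =
     (if m \<le> i then smult (of_nat (i choose m)) ((Dh h ^^ (i - m)) f) else 0)"
proof (cases "m \<le> i")
  case True
  have "coeff (ypow_mult h i f) m =
     (\<Sum>k\<le>i. if k = i - m then smult (of_nat (i choose k)) ((Dh h ^^ k) f) else 0)"
    unfolding ypow_mult_def coeff_sum coeff_monom
    by (rule sum.cong) (use True in auto)
  also have "\<dots> = smult (of_nat (i choose (i - m))) ((Dh h ^^ (i - m)) f)"
    by (subst sum.delta) auto
  finally show ?thesis using True by (simp add: binomial_symmetric[OF True, symmetric])
next
  case False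
  then show ?thesis unfolding ypow_mult_def coeff_sum coeff_monom
    by (auto intro!: sum.neutral)
qed

lemma ypow_mult_eq: "ypow_mult h i f = (ymul h ^^ i) [:f:]"
  by (rule poly_eqI) (simp add: coeff_ymul_funpow_const coeff_ypow_mult)

lemma smult_sum_right: "smult c (\<Sum>i\<in>A. f i) = (\<Sum>i\<in>A. smult c (f i))"
  by (induction A rule: infinite_finite_induct) (auto simp: smult_add_right)

lemma Amult_eq: "Amult h P Q = (\<Sum>i\<le>degree P. smult (coeff P i) ((ymul h ^^ i) Q))"
proof -
  have Q: "Q = (\<Sum>j\<le>degree Q. monom 1 j * [:coeff Q j:])"
    by (subst (1) poly_as_sum_of_monoms[symmetric])
       (simp add: mult_monom monom_0[symmetric] del: monom_0)
  have "(ymul h ^^ i) Q = (\<Sum>j\<le>degree Q. monom 1 j * ypow_mult h i (coeff Q j))" for i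
    by (subst Q) (simp only: ymul_funpow_sum ymul_funpow_monom_mult ypow_mult_eq)
  then show ?thesis
    by (simp add: Amult_def smult_sum_right mult_smult_left mult.commute)
qed

lemma Amult_bound:
  assumes "degree P \<le> N"
  shows "Amult h P Q = (\<Sum>i\<le>N. smult (coeff P i) ((ymul h ^^ i) Q))"
  unfolding Amult_eq by (rule sum.mono_neutral_left) (use assms in \<open>auto simp: coeff_eq_0\<close>)

lemma Amult_add_left: "Amult h (P + P') Q = Amult h P Q + Amult h P' Q"
proof -
  let ?N = "max (degree P) (degree P')"
  have "degree (P + P') \<le> ?N" by (rule degree_add_le) auto
  then show ?thesis
    by (simp add: Amult_bound[of _ ?N] smult_add_left sum.distrib)
qed

lemma Amult_diff_left: "Amult h (P - P') Q = Amult h P Q - Amult h P' Q"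
  using Amult_add_left[of h "P - P'" P' Q] by (simp add: algebra_simps)

lemma Amult_0_left [simp]: "Amult h 0 Q = 0"
  by (simp add: Amult_eq)

lemma Amult_0_right [simp]: "Amult h P 0 = 0"
  by (simp add: Amult_eq)

lemma Amult_sum_left: "Amult h (\<Sum>i\<in>A. P i) Q = (\<Sum>i\<in>A. Amult h (P i) Q)"
  by (induction A rule: infinite_finite_induct) (auto simp: Amult_add_left)

lemma Amult_smult_left: "Amult h (smult f P) Q = smult f (Amult h P Q)"
  by (simp add: Amult_bound[OF degree_smult_le] Amult_eq smult_sum_right)

lemma Amult_add_right: "Amult h P (Q + Q') = Amult h P Q + Amult h P Q'"
  by (simp add: Amult_eq ymul_funpow_add smult_add_right sum.distrib)

lemma Amult_monom_left: "Amult h (monom p i) Q = smult p ((ymul h ^^ i) Q)"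
proof -
  have "degree (monom p i) \<le> i" by (simp add: degree_monom_le)
  from Amult_bound[OF this] show ?thesis
    by (simp add: coeff_monom if_distrib[of "\<lambda>c. smult c _"] cong: if_cong)
qed

lemma Amult_Aemb_left: "Amult h (Aemb f) Q = smult f Q"
  using Amult_monom_left[of h f 0 Q] by (simp add: Aemb_def monom_0)

lemma Amult_Aemb_Aemb: "Amult h (Aemb f) (Aemb g) = Aemb (f * g)"
  unfolding Amult_Aemb_left by (simp add: Aemb_def)

definition Y :: "'a::comm_semiring_1 poly poly" where
  "Y = monom 1 1"

lemma Amult_Y_left: "Amult h Y Q = ymul h Q"
  by (simp add: Y_def Amult_monom_left)

lemma Amult_Y_right: "Amult h P Y = pCons 0 P"
proof -
  have "Amult h P Y = (\<Sum>i\<le>degree P. monom (coeff P i) (Suc i))"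
    using ymul_funpow_monom_const[where h=h and c=1 and k=1]
    by (simp add: Y_def Amult_eq smult_monom one_pCons[symmetric] del: one_pCons)
  also have "\<dots> = monom 1 1 * (\<Sum>i\<le>degree P. monom (coeff P i) i)"
    by (simp add: sum_distrib_left mult_monom)
  also have "\<dots> = pCons 0 P"
    by (rule poly_eqI) (auto simp: poly_as_sum_of_monoms coeff_monom_mult coeff_pCons split: nat.split)
  finally show ?thesis .
qed

lemma ymul_Amult: "ymul h (Amult h P Q) = Amult h (ymul h P) Q"
proof -
  have "ymul h (Amult h P Q) = (\<Sum>i\<le>degree P. ymul h (smult (coeff P i) ((ymul h ^^ i) Q)))"
    by (simp add: Amult_eq ymul_sum)
  also have "\<dots> = (\<Sum>i\<le>degree P. Amult h (ymul h (monom (coeff P i) i)) Q)"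
    by (intro sum.cong refl)
       (simp add: ymul_smult ymul_monom Amult_add_left Amult_monom_left)
  also have "\<dots> = Amult h (ymul h (\<Sum>i\<le>degree P. monom (coeff P i) i)) Q"
    by (simp add: ymul_sum Amult_sum_left)
  finally show ?thesis by (simp add: poly_as_sum_of_monoms)
qed

lemma Amult_assoc: "Amult h (Amult h P Q) R = Amult h P (Amult h Q R)"
proof -
  have ypow: "Amult h ((ymul h ^^ i) Q) R = (ymul h ^^ i) (Amult h Q R)" for i
    by (induction i) (auto simp: ymul_Amult[symmetric])
  have "Amult h (Amult h P Q) R =
      (\<Sum>i\<le>degree P. smult (coeff P i) (Amult h ((ymul h ^^ i) Q) R))"
    unfolding Amult_eq[of h P Q] Amult_sum_left by (simp add: Amult_smult_left)
  then show ?thesis by (simp add: ypow Amult_eq[of h P])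
qed

lemma degree_ymul_funpow:
  assumes "Q \<noteq> 0"
  shows "degree ((ymul h ^^ i) Q) = degree Q + i \<and>
         coeff ((ymul h ^^ i) Q) (degree Q + i) = lead_coeff Q"
proof (induction i)
  case (Suc i)
  let ?Q = "(ymul h ^^ i) Q"
  have "?Q \<noteq> 0" using Suc assms by (metis leading_coeff_0_iff)
  moreover have "degree (ymul h ?Q) \<le> Suc (degree ?Q)"
    by (rule degree_le) (auto simp: coeff_ymul coeff_eq_0)
  ultimately have "degree (ymul h ?Q) = Suc (degree ?Q)"
    "coeff (ymul h ?Q) (Suc (degree ?Q)) = lead_coeff ?Q"
    by (auto simp: coeff_ymul coeff_eq_0 intro!: antisym le_degree)
  then show ?case using Suc by simp
qed simp

lemma Amult_degree:
  assumes "P \<noteq> 0" "Q \<noteq> 0"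
  shows "degree (Amult h P Q) = degree P + degree Q \<and>
         lead_coeff (Amult h P Q) = lead_coeff P * lead_coeff Q"
proof -
  let ?n = "degree P" and ?m = "degree Q"
  have coeff_term: "coeff P i * coeff ((ymul h ^^ i) Q) k =
      (if i = ?n \<and> k = ?n + ?m then lead_coeff P * lead_coeff Q else 0)"
    if "i \<le> ?n" "?n + ?m \<le> k" for i k
    using degree_ymul_funpow[OF assms(2), where h=h and i=i] that
    by (cases "i = ?n \<and> k = ?n + ?m") (auto simp: add.commute coeff_eq_0)
  have top: "coeff (Amult h P Q) k = (if k = ?n + ?m then lead_coeff P * lead_coeff Q else 0)"
    if "?n + ?m \<le> k" for k
  proof -
    have "coeff (Amult h P Q) k =
        (\<Sum>i\<le>?n. if i = ?n \<and> k = ?n + ?m then lead_coeff P * lead_coeff Q else 0)"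
      unfolding Amult_eq coeff_sum coeff_smult by (rule sum.cong) (use that coeff_term in auto)
    then show ?thesis by (simp add: sum.delta')
  qed
  have "degree (Amult h P Q) = ?n + ?m"
    using assms by (intro antisym degree_le le_degree) (auto simp: top)
  then show ?thesis by (simp add: top)
qed

lemma Amult_nonzero: "P \<noteq> 0 \<Longrightarrow> Q \<noteq> 0 \<Longrightarrow> Amult h P Q \<noteq> 0"
  using Amult_degree[of P Q h] by (metis leading_coeff_0_iff mult_eq_0_iff)

lemma Ah_induct [case_names add mult emb Y]:
  assumes add: "\<And>a b. P a \<Longrightarrow> P b \<Longrightarrow> P (a + b)"
    and mult: "\<And>a b. P a \<Longrightarrow> P b \<Longrightarrow> P (Amult h a b)"
    and emb: "\<And>f. P (Aemb f)"
    and Y: "P Y"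
  shows "P a"
proof -
  have ypow: "P (monom 1 i)" for i
  proof (induction i)
    case 0
    then show ?case using emb[of 1] by (simp add: Aemb_def monom_0 one_pCons)
  next
    case (Suc i)
    have "Amult h Y (monom 1 i) = monom 1 (Suc i)"
      unfolding Amult_Y_left by (simp add: ymul_monom Dh_def)
    then show ?case using mult[OF Y Suc] by simp
  qed
  have monom: "P (monom f i)" for f i
    using mult[OF emb[of f] ypow[of i]] by (simp add: Amult_Aemb_left smult_monom)
  have "P (\<Sum>i\<in>A. monom (coeff a i) i)" for A :: "nat set"
    by (induction A rule: infinite_finite_induct)
       (use emb[of 0] in \<open>auto simp: Aemb_def intro: add monom\<close>)
  from this[of "{..degree a}"] show ?thesis by (simp add: poly_as_sum_of_monoms)
qed

section \<open>Central elements and the backward direction\<close>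

text \<open>Since \<open>P y = y P - D\<^sub>h(P)\<close> coefficientwise, an element commutes with \<open>y\<close> exactly
  when \<open>D\<^sub>h\<close> kills all its coefficients.\<close>
lemma commutes_Y_iff: "Amult h P Y = Amult h Y P \<longleftrightarrow> map_poly (Dh h) P = 0"
  by (simp add: Amult_Y_left Amult_Y_right ymul_def)

lemma map_poly_Dh_const [simp]: "map_poly (Dh h) [:u:] = [:Dh h u:]"
  by (rule poly_eqI) (simp add: coeff_map_poly coeff_pCons split: nat.split)

lemma Aemb_commute: "Amult h (Aemb f) (Aemb g) = Amult h (Aemb g) (Aemb f)"
  by (simp add: Amult_Aemb_Aemb mult.commute)

lemma central_if_commutes_with_generators:
  assumes emb: "\<And>f. Amult h z (Aemb f) = Amult h (Aemb f) z"
    and Y: "Amult h z Y = Amult h Y z"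
  shows "z \<in> Acenter h"
proof -
  have "Amult h z a = Amult h a z" for a
  proof (induction a rule: Ah_induct[where h = h])
    case (add a b)
    then show ?case by (simp add: Amult_add_left Amult_add_right)
  next
    case (mult a b)
    have "Amult h z (Amult h a b) = Amult h a (Amult h z b)"
      using mult(1) by (metis Amult_assoc)
    also have "\<dots> = Amult h (Amult h a b) z"
      using mult(2) by (simp add: Amult_assoc)
    finally show ?case .
  qed (use emb Y in auto)
  then show ?thesis by (simp add: Acenter_def)
qed

lemma Aemb_central_iff:
  assumes "h \<noteq> 0"
  shows "Aemb u \<in> Acenter h \<longleftrightarrow> pderiv u = 0"
proof
  assume "Aemb u \<in> Acenter h"
  then have "map_poly (Dh h) (Aemb u) = 0"
    by (simp add: Acenter_def flip: commutes_Y_iff)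
  then show "pderiv u = 0" using assms by (simp add: Aemb_def Dh_def)
next
  assume "pderiv u = 0"
  then have "map_poly (Dh h) (Aemb u) = 0" by (simp add: Aemb_def Dh_def)
  then show "Aemb u \<in> Acenter h"
    by (intro central_if_commutes_with_generators Aemb_commute) (simp add: commutes_Y_iff)
qed

definition separable_factors :: "'a::field poly \<Rightarrow> 'a poly set" where
  "separable_factors h = {u. irreducible u \<and> lead_coeff u = 1 \<and> u dvd h \<and> pderiv u \<noteq> 0}"

lemma noncentral_factors_eq:
  "h \<noteq> 0 \<Longrightarrow> noncentral_factors h = separable_factors h"
  by (auto simp: noncentral_factors_def separable_factors_def Aemb_central_iff)

text \<open>If \<open>D\<^sub>h f = f w\<close>, then \<open>f y = (y - w) f\<close> and \<open>y f = f (y + w)\<close>; hence \<open>f\<close> can be moved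
  past any element, from either side.\<close>
lemma Aemb_move_left:
  assumes D: "Dh h f = f * w"
  shows "\<exists>a'. Amult h (Aemb f) a = Amult h a' (Aemb f)"
proof (induction a rule: Ah_induct[where h = h])
  case (add a b)
  then obtain a' b' where "Amult h (Aemb f) a = Amult h a' (Aemb f)"
    "Amult h (Aemb f) b = Amult h b' (Aemb f)" by blast
  then show ?case by (intro exI[of _ "a' + b'"]) (simp add: Amult_add_left Amult_add_right)
next
  case (mult a b)
  then obtain a' b' where ab: "Amult h (Aemb f) a = Amult h a' (Aemb f)"
    "Amult h (Aemb f) b = Amult h b' (Aemb f)" by blast
  have "Amult h (Aemb f) (Amult h a b) = Amult h (Amult h a' b') (Aemb f)"
    by (simp add: Amult_assoc[symmetric] ab(1)) (simp add: Amult_assoc ab(2))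
  then show ?case by blast
next
  case Y
  have "Amult h (Aemb f) Y = Amult h (Y - Aemb w) (Aemb f)"
    unfolding Amult_diff_left Amult_Y_left Amult_Aemb_left
    using D by (simp add: Aemb_def Y_def ymul_def monom_Suc mult.commute)
  then show ?case by blast
qed (use Aemb_commute in blast)

lemma Aemb_move_right:
  assumes D: "Dh h f = f * w"
  shows "\<exists>a'. Amult h a (Aemb f) = Amult h (Aemb f) a'"
proof (induction a rule: Ah_induct[where h = h])
  case (add a b)
  then obtain a' b' where "Amult h a (Aemb f) = Amult h (Aemb f) a'"
    "Amult h b (Aemb f) = Amult h (Aemb f) b'" by blast
  then show ?case by (intro exI[of _ "a' + b'"]) (simp add: Amult_add_left Amult_add_right)
next
  case (mult a b)
  then obtain a' b' where ab: "Amult h a (Aemb f) = Amult h (Aemb f) a'"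
    "Amult h b (Aemb f) = Amult h (Aemb f) b'" by blast
  have "Amult h (Amult h a b) (Aemb f) = Amult h (Aemb f) (Amult h a' b')"
    by (simp add: Amult_assoc ab(2)) (simp add: Amult_assoc[symmetric] ab(1))
  then show ?case by blast
next
  case Y
  have "Amult h Y (Aemb f) = Amult h (Aemb f) (Y + Aemb w)"
    unfolding Amult_add_right Amult_Y_left Amult_Aemb_left
    using D by (simp add: Aemb_def Y_def ymul_def monom_Suc)
  then show ?case by blast
qed (use Aemb_commute in blast)

lemma normal_Aemb_mult_central:
  assumes D: "f dvd Dh h f" and z: "z \<in> Acenter h"
  shows "Anormal h (Amult h (Aemb f) z)"
proof -
  obtain w where w: "Dh h f = f * w" using D by blast
  have zc: "Amult h z a = Amult h a z" for a using z by (simp add: Acenter_def)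
  let ?v = "Amult h (Aemb f) z"
  have "Amult h ?v a \<in> {Amult h a ?v | a. True}" for a
  proof -
    obtain a' where a': "Amult h (Aemb f) a = Amult h a' (Aemb f)"
      using Aemb_move_left[OF w] by blast
    have "Amult h ?v a = Amult h a' ?v"
      by (simp add: Amult_assoc zc[of a]) (simp add: Amult_assoc[symmetric] a')
    then show ?thesis by blast
  qed
  moreover have "Amult h a ?v \<in> {Amult h ?v a | a. True}" for a
  proof -
    obtain a' where a': "Amult h a (Aemb f) = Amult h (Aemb f) a'"
      using Aemb_move_right[OF w] by blast
    have "Amult h a ?v = Amult h ?v a'"
      by (simp add: Amult_assoc[symmetric] a') (simp add: Amult_assoc zc)
    then show ?thesis by blast
  qed
  ultimately show ?thesis unfolding Anormal_def by blast
qed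

lemma Dh_stable_prod:
  assumes "\<And>u. u \<in> N \<Longrightarrow> u dvd h"
  shows "(\<Prod>u\<in>N. u ^ \<beta> u) dvd Dh h (\<Prod>u\<in>N. u ^ \<beta> u)"
proof -
  have mult: "p * q dvd Dh h (p * q)" if "p dvd Dh h p" "q dvd Dh h q" for p q
    using that by (simp add: Dh_mult mult_dvd_mono)
  have power: "u ^ n dvd Dh h (u ^ n)" if "u dvd h" for u n
  proof (induction n)
    case (Suc n)
    have "u dvd Dh h u" using that by (simp add: Dh_def)
    from mult[OF this Suc] show ?case by simp
  qed (simp add: Dh_def)
  show ?thesis
    using assms
  proof (induction N rule: infinite_finite_induct)
    case (insert x F)
    then show ?case by (simp add: mult power)
  qed (simp_all add: Dh_def)
qed

section \<open>Multiplicities of irreducible factors and derivatives\<close>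

lemma degree_pderiv_le: "degree (pderiv p) \<le> degree p - 1"
  by (rule degree_le) (auto simp: coeff_pderiv coeff_eq_0)

lemma pderiv_degree_0: "degree p = 0 \<Longrightarrow> pderiv p = 0"
  by (metis degree_eq_zeroE pderiv.simps)

text \<open>A polynomial never divides a nonzero multiple of its own derivative, as the latter has
  smaller degree.\<close>
lemma dvd_smult_pderiv_self:
  fixes p :: "'a::field poly"
  assumes "p dvd smult c (pderiv p)"
  shows "smult c (pderiv p) = 0"
proof (rule ccontr)
  assume nz: "smult c (pderiv p) \<noteq> 0"
  then have "pderiv p \<noteq> 0" by auto
  then have "degree p > 0" using pderiv_degree_0 by blast
  have "degree p \<le> degree (smult c (pderiv p))" by (rule dvd_imp_degree_le[OF assms nz])
  also have "\<dots> \<le> degree p - 1" using degree_smult_le degree_pderiv_le order_trans by blast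
  finally show False using \<open>degree p > 0\<close> by simp
qed

lemma pderiv_power_mult:
  "p * pderiv (p ^ e * q) = p ^ e * (smult (of_nat e) (pderiv p * q) + p * pderiv q)"
proof (cases e)
  case (Suc k)
  have "pderiv (p ^ Suc k * q) = p ^ Suc k * pderiv q + q * (smult (of_nat (Suc k)) (p ^ k) * pderiv p)"
    by (simp only: pderiv_mult pderiv_power_Suc)
  then show ?thesis using Suc by (simp add: algebra_simps)
qed simp

definition monic_assoc :: "'a::field poly \<Rightarrow> 'a poly" where
  "monic_assoc p = smult (inverse (lead_coeff p)) p"

context
begin

text \<open>Polynomials over an arbitrary field form a factorial ring. The library establishes this by
  an interpretation that is local to its theory; we repeat it here to use multiplicities and
  prime factorizations.\<close>
interpretation field_poly:
  normalization_euclidean_semiring_multiplicative where zero = "0 :: 'a :: field poly"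
    and one = 1 and plus = plus and minus = minus
    and times = times
    and normalize = "\<lambda>p. smult (inverse (lead_coeff p)) p"
    and unit_factor = "\<lambda>p. [:lead_coeff p:]"
    and euclidean_size = "\<lambda>p. if p = 0 then 0 else 2 ^ degree p"
    and divide = divide and modulo = modulo
  rewrites "dvd.dvd (times :: 'a poly \<Rightarrow> _) = Rings.dvd"
    and "comm_monoid_mult.prod_mset times 1 = prod_mset"
    and "comm_semiring_1.irreducible times 1 0 = irreducible"
    and "comm_semiring_1.prime_elem times 1 0 = prime_elem"
    and "power.power (1::'a poly) times = power"
    and "comm_monoid_mult.prod times (1::'a poly) = prod"
proof -
  show "power.power (1::'a poly) times = power" by (simp add: power_dict)
  show "comm_monoid_mult.prod times (1::'a poly) = prod" by (simp add: prod_dict)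
  show "dvd.dvd (times :: 'a poly \<Rightarrow> _) = Rings.dvd" by (simp add: dvd_dict)
  show "comm_monoid_mult.prod_mset times 1 = prod_mset" by (simp add: prod_mset_dict)
  show "comm_semiring_1.irreducible times 1 0 = irreducible" by (simp add: irreducible_dict)
  show "comm_semiring_1.prime_elem times 1 0 = prime_elem" by (simp add: prime_elem_dict)
  show "class.normalization_euclidean_semiring_multiplicative divide plus minus (0 :: 'a poly) times 1
    modulo (\<lambda>p. if p = 0 then 0 else 2 ^ degree p)
    (\<lambda>p. [:lead_coeff p:]) (\<lambda>p. smult (inverse (lead_coeff p)) p)"
  proof (standard, fold dvd_dict)
    fix p :: "'a poly"
    show "[:lead_coeff p:] * smult (inverse (lead_coeff p)) p = p"
      by (cases "p = 0") simp_all
  next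
    fix p :: "'a poly" assume "is_unit p"
    then show "[:lead_coeff p:] = p"
      by (elim is_unit_polyE) (auto simp: monom_0 one_poly_def field_simps)
  next
    fix p :: "'a poly" assume "p \<noteq> 0"
    then show "is_unit [:lead_coeff p:]"
      by (simp add: is_unit_pCons_iff)
  next
    fix a b :: "'a poly" assume "is_unit a"
    then show "[:lead_coeff (a * b):] = a * [:lead_coeff b:]"
      by (auto elim!: is_unit_polyE)
  qed (auto simp: lead_coeff_mult Rings.div_mult_mod_eq intro!: degree_mod_less' degree_mult_right_le)
qed

text \<open>The separable factors of \<open>h \<noteq> 0\<close> are among its finitely many prime factors.\<close>
lemma finite_separable_factors:
  assumes "h \<noteq> 0"
  shows "finite (separable_factors h)"
proof (rule finite_subset)
  show "separable_factors h \<subseteq> set_mset (field_poly.prime_factorization h)"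
    using assms by (auto simp: separable_factors_def field_poly.in_prime_factors_iff
        field_poly.prime_def field_poly.prime_elem_iff_irreducible)
qed simp

lemma prime_power_split:
  fixes p g :: "'a::field poly"
  assumes p: "prime_elem p" and g: "g \<noteq> 0"
  defines "e \<equiv> field_poly.multiplicity p g"
  obtains q where "g = p ^ e * q" "\<not> p dvd q"
    "p * pderiv g = p ^ e * (smult (of_nat e) (pderiv p * q) + p * pderiv q)"
proof -
  obtain q where q: "g = p ^ e * q" "\<not> p dvd q"
    using field_poly.multiplicity_decompose'[OF g] p unfolding e_def
    by (metis prime_elem_not_unit)
  show ?thesis by (rule that[OF q]) (simp add: q(1) pderiv_power_mult)
qed

lemma log_deriv_multiplicity:
  fixes p g1 g2 :: "'a::field poly"
  assumes p: "prime_elem p" and nz: "g1 \<noteq> 0" "g2 \<noteq> 0"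
    and eq: "pderiv g1 * g2 = g1 * pderiv g2"
  shows "smult (of_nat (field_poly.multiplicity p g1)) (pderiv p) =
         smult (of_nat (field_poly.multiplicity p g2)) (pderiv p)"
proof -
  define e1 where "e1 = field_poly.multiplicity p g1"
  define e2 where "e2 = field_poly.multiplicity p g2"
  obtain q1 where q1: "g1 = p ^ e1 * q1" "\<not> p dvd q1"
    and d1: "p * pderiv g1 = p ^ e1 * (smult (of_nat e1) (pderiv p * q1) + p * pderiv q1)"
    using prime_power_split[OF p nz(1)] unfolding e1_def .
  obtain q2 where q2: "g2 = p ^ e2 * q2" "\<not> p dvd q2"
    and d2: "p * pderiv g2 = p ^ e2 * (smult (of_nat e2) (pderiv p * q2) + p * pderiv q2)"
    using prime_power_split[OF p nz(2)] unfolding e2_def .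
  define A1 where "A1 = smult (of_nat e1) (pderiv p * q1) + p * pderiv q1"
  define A2 where "A2 = smult (of_nat e2) (pderiv p * q2) + p * pderiv q2"
  have "p ^ (e1 + e2) * (A1 * q2) = (p * pderiv g1) * g2"
    by (simp add: d1 q2(1) A1_def power_add algebra_simps)
  also have "\<dots> = g1 * (p * pderiv g2)" using eq by (simp add: algebra_simps)
  also have "\<dots> = p ^ (e1 + e2) * (q1 * A2)"
    by (simp add: d2 q1(1) A2_def power_add algebra_simps)
  finally have "A1 * q2 = q1 * A2" using p by simp
  then have "smult (of_nat e1 - of_nat e2) (pderiv p) * (q1 * q2) =
      p * (q1 * pderiv q2 - pderiv q1 * q2)"
    unfolding A1_def A2_def by (simp add: smult_diff_left algebra_simps)
  then have "p dvd smult (of_nat e1 - of_nat e2) (pderiv p) * (q1 * q2)" by simp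
  then have "p dvd smult (of_nat e1 - of_nat e2) (pderiv p) \<or> p dvd q1 * q2"
    by (rule prime_elem_dvd_multD[OF p])
  moreover have "\<not> p dvd q1 * q2" using q1(2) q2(2) p by (simp add: prime_elem_dvd_mult_iff)
  ultimately have "p dvd smult (of_nat e1 - of_nat e2) (pderiv p)" by blast
  then have "smult (of_nat e1 - of_nat e2) (pderiv p) = 0" by (rule dvd_smult_pderiv_self)
  then show ?thesis unfolding e1_def e2_def by (simp add: smult_diff_left)
qed

lemma coprime_log_deriv_multiplicity:
  fixes p g a b :: "'a::field poly"
  assumes p: "prime_elem p" and a: "\<not> p dvd a" and g: "g \<noteq> 0"
    and eq: "a * pderiv g = b * g"
  shows "smult (of_nat (field_poly.multiplicity p g)) (pderiv p) = 0"
proof -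
  define e where "e = field_poly.multiplicity p g"
  obtain q where q: "g = p ^ e * q" "\<not> p dvd q"
    and d: "p * pderiv g = p ^ e * (smult (of_nat e) (pderiv p * q) + p * pderiv q)"
    using prime_power_split[OF p g] unfolding e_def .
  define A where "A = smult (of_nat e) (pderiv p * q) + p * pderiv q"
  have "p ^ e * (a * A) = a * (p * pderiv g)" by (simp add: d A_def algebra_simps)
  also have "\<dots> = p ^ e * (p * (b * q))"
    by (simp only: mult.left_commute[of a p] eq) (simp add: q(1) algebra_simps)
  finally have "a * A = p * (b * q)" using p by simp
  then have "a * (smult (of_nat e) (pderiv p) * q) = p * (b * q - a * pderiv q)"
    unfolding A_def by (simp add: algebra_simps)
  then have "p dvd a * (smult (of_nat e) (pderiv p) * q)" by simp
  then have "p dvd a \<or> p dvd smult (of_nat e) (pderiv p) * q"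
    by (rule prime_elem_dvd_multD[OF p])
  then have "p dvd smult (of_nat e) (pderiv p)"
    using a q(2) prime_elem_dvd_multD[OF p] by blast
  then show ?thesis unfolding e_def by (rule dvd_smult_pderiv_self)
qed

text \<open>Conversely, if every prime \<open>p\<close> occurs in \<open>c\<close> with multiplicity \<open>e\<^sub>p\<close> such that
  \<open>e\<^sub>p p' = 0\<close>, then \<open>c' = 0\<close>: otherwise \<open>c\<close> would divide \<open>c'\<close>.\<close>
lemma pderiv_eq_0_by_multiplicities:
  fixes c :: "'a::field poly"
  assumes c: "c \<noteq> 0"
    and mult: "\<And>p. prime_elem p \<Longrightarrow> smult (of_nat (field_poly.multiplicity p c)) (pderiv p) = 0"
  shows "pderiv c = 0"
proof (rule ccontr)
  assume c': "pderiv c \<noteq> 0"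
  have "c dvd pderiv c"
  proof (rule field_poly.multiplicity_le_imp_dvd[OF c])
    fix p :: "'a poly" assume "field_poly.prime p"
    then have p: "prime_elem p" by (simp add: field_poly.prime_def)
    define e where "e = field_poly.multiplicity p c"
    obtain q where q: "p * pderiv c = p ^ e * (smult (of_nat e) (pderiv p * q) + p * pderiv q)"
      using prime_power_split[OF p c] unfolding e_def by blast
    have "smult (of_nat e) (pderiv p * q) = 0"
      using mult[OF p] unfolding e_def by (metis mult_smult_left mult_zero_left)
    then have "p * pderiv c = p * (p ^ e * pderiv q)" using q by (metis add_0 mult.left_commute)
    then have "p ^ e dvd pderiv c" using p by simp
    then show "field_poly.multiplicity p c \<le> field_poly.multiplicity p (pderiv c)"
      using field_poly.power_dvd_iff_le_multiplicity[OF c'] p by (simp add: e_def prime_elem_not_unit)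
  qed
  then have "degree c \<le> degree (pderiv c)" using c' by (rule dvd_imp_degree_le)
  then have "degree c = 0" using degree_pderiv_le[of c] by simp
  with c' show False by (simp add: pderiv_degree_0)
qed


lemma monic_assoc:
  fixes p :: "'a::field poly"
  assumes p: "prime_elem p"
  shows "irreducible (monic_assoc p)" "lead_coeff (monic_assoc p) = 1"
    "p dvd monic_assoc p" "monic_assoc p dvd p"
    "field_poly.multiplicity (monic_assoc p) x = field_poly.multiplicity p x"
    "field_poly.multiplicity p (monic_assoc p) = 1"
    "pderiv (monic_assoc p) = 0 \<longleftrightarrow> pderiv p = 0"
proof -
  have nz: "p \<noteq> 0" using p by auto
  have unit: "is_unit [:inverse (lead_coeff p):]" using nz by (simp add: is_unit_triv)
  have eq: "monic_assoc p = [:inverse (lead_coeff p):] * p" by (simp add: monic_assoc_def)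
  show "irreducible (monic_assoc p)"
    unfolding eq using irreducible_mult_unit_left[OF unit] p
    by (simp add: field_poly.prime_elem_iff_irreducible)
  show "lead_coeff (monic_assoc p) = 1" using nz by (simp add: monic_assoc_def)
  show "p dvd monic_assoc p" unfolding eq by simp
  have "p = [:lead_coeff p:] * monic_assoc p" using nz by (simp add: monic_assoc_def)
  then show "monic_assoc p dvd p" by (metis dvd_triv_right)
  show "field_poly.multiplicity (monic_assoc p) x = field_poly.multiplicity p x"
    unfolding eq by (rule field_poly.multiplicity_times_unit_left[OF unit])
  show "field_poly.multiplicity p (monic_assoc p) = 1"
    unfolding eq field_poly.multiplicity_times_unit_right[OF unit]
    using p by (rule field_poly.multiplicity_prime)
  show "pderiv (monic_assoc p) = 0 \<longleftrightarrow> pderiv p = 0"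
    using nz by (simp add: monic_assoc_def pderiv_smult)
qed

lemma monic_assoc_unique:
  fixes p u :: "'a::field poly"
  assumes p: "prime_elem p" and u: "irreducible u" "lead_coeff u = 1" and d: "p dvd u"
  shows "u = monic_assoc p"
proof -
  obtain c where c: "u = p * c" using d by blast
  then have "is_unit c" using u(1) p by (auto simp: irreducible_def prime_elem_def)
  then obtain c0 where c0: "c = [:c0:]" "c0 \<noteq> 0" by (auto elim!: is_unit_polyE' simp: monom_0)
  have "lead_coeff p * c0 = 1" using u(2) c c0 by (simp add: lead_coeff_mult mult.commute)
  moreover have "lead_coeff p \<noteq> 0" using p by auto
  ultimately have "c0 = inverse (lead_coeff p)" by (simp add: field_simps)
  then show ?thesis using c c0 by (simp add: monic_assoc_def mult.commute)
qed

lemma multiplicity_prod_monic_irreducibles: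
  fixes p :: "'a::field poly" and N :: "'a poly set"
  assumes p: "prime_elem p" and N: "finite N"
    and irred: "\<And>u. u \<in> N \<Longrightarrow> irreducible u \<and> lead_coeff u = 1"
  shows "field_poly.multiplicity p (\<Prod>u\<in>N. u ^ \<beta> u) =
    (if monic_assoc p \<in> N then \<beta> (monic_assoc p) else 0)"
proof -
  have nz: "u \<noteq> 0" if "u \<in> N" for u using irred[OF that] by auto
  have factor: "field_poly.multiplicity p (u ^ \<beta> u) = (if u = monic_assoc p then \<beta> u else 0)"
    if u: "u \<in> N" for u
  proof (cases "p dvd u")
    case True
    then have "u = monic_assoc p" using monic_assoc_unique[OF p] irred[OF u] by blast
    then show ?thesis
      using monic_assoc(6)[OF p] p nz[OF u]
      by (simp add: field_poly.prime_elem_multiplicity_power_distrib)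
  next
    case False
    then show ?thesis using monic_assoc(3)[OF p] nz[OF u] p
      by (auto simp: field_poly.prime_elem_multiplicity_power_distrib
          field_poly.prime_elem_multiplicity_eq_zero_iff)
  qed
  have "field_poly.multiplicity p (\<Prod>u\<in>N. u ^ \<beta> u) = (\<Sum>u\<in>N. field_poly.multiplicity p (u ^ \<beta> u))"
    by (rule field_poly.prime_elem_multiplicity_prod_distrib[OF p]) (use nz N in auto)
  also have "\<dots> = (\<Sum>u\<in>N. if u = monic_assoc p then \<beta> u else 0)"
    by (rule sum.cong) (simp_all add: factor)
  finally show ?thesis using N by (simp add: sum.delta')
qed


lemma eigen_multiplicity_cong:
  fixes h t p :: "'a::field poly" and g :: "nat \<Rightarrow> 'a poly"
  assumes h: "h \<noteq> 0" and eig: "\<And>j. h * pderiv (g j) = t * g j"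
    and nz: "g i \<noteq> 0" "g j \<noteq> 0" and p: "prime_elem p" "pderiv p \<noteq> 0"
  shows "of_nat (field_poly.multiplicity p (g i)) = (of_nat (field_poly.multiplicity p (g j)) :: 'a)"
proof -
  have "h * (pderiv (g i) * g j) = h * (g i * pderiv (g j))"
    by (metis eig mult.assoc mult.left_commute)
  then have "pderiv (g i) * g j = g i * pderiv (g j)" using h by simp
  from log_deriv_multiplicity[OF p(1) nz this]
  have "smult (of_nat (field_poly.multiplicity p (g i)) - of_nat (field_poly.multiplicity p (g j)))
      (pderiv p) = 0"
    by (simp add: smult_diff_left)
  then show ?thesis using p(2) by simp
qed

lemma eigen_poly_factor:
  fixes h t g :: "'a::field poly" and \<beta> :: "'a poly \<Rightarrow> nat"
  assumes h: "h \<noteq> 0" and eig: "h * pderiv g = t * g" and g: "g \<noteq> 0"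
    and le: "\<And>u. u \<in> separable_factors h \<Longrightarrow> \<beta> u \<le> field_poly.multiplicity u g"
    and cong: "\<And>u. u \<in> separable_factors h \<Longrightarrow>
      of_nat (field_poly.multiplicity u g) = (of_nat (\<beta> u) :: 'a)"
  defines "f \<equiv> \<Prod>u\<in>separable_factors h. u ^ \<beta> u"
  shows "f dvd g" and "pderiv (g div f) = 0"
proof -
  define N where "N = separable_factors h"
  have N: "finite N" using h by (simp add: N_def finite_separable_factors)
  have irred: "irreducible u \<and> lead_coeff u = 1" if "u \<in> N" for u
    using that by (simp add: N_def separable_factors_def)
  have f_nz: "f \<noteq> 0" unfolding f_def N_def[symmetric] using N irred[of 0] by (auto simp: prod_zero_iff)
  have mult_f: "field_poly.multiplicity p f = (if monic_assoc p \<in> N then \<beta> (monic_assoc p) else 0)"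
    if "prime_elem p" for p
    unfolding f_def N_def[symmetric] by (rule multiplicity_prod_monic_irreducibles[OF that N irred])
  show dvd: "f dvd g"
  proof (rule field_poly.multiplicity_le_imp_dvd[OF f_nz])
    fix p :: "'a poly" assume "field_poly.prime p"
    then have p: "prime_elem p" by (simp add: field_poly.prime_def)
    show "field_poly.multiplicity p f \<le> field_poly.multiplicity p g"
      using mult_f[OF p] le[of "monic_assoc p"] monic_assoc(5)[OF p] by (simp add: N_def)
  qed
  define c where "c = g div f"
  have g_eq: "g = f * c" unfolding c_def using dvd by simp
  have c_nz: "c \<noteq> 0" using g g_eq by auto
  have "pderiv c = 0"
  proof (rule pderiv_eq_0_by_multiplicities[OF c_nz])
    fix p :: "'a poly" assume p: "prime_elem p"
    have mult_g: "field_poly.multiplicity p g =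
        field_poly.multiplicity p f + field_poly.multiplicity p c"
      unfolding g_eq by (rule field_poly.prime_elem_multiplicity_mult_distrib[OF p f_nz c_nz])
    show "smult (of_nat (field_poly.multiplicity p c)) (pderiv p) = 0"
    proof (cases "monic_assoc p \<in> N")
      case True
      then show ?thesis
        using mult_g mult_f[OF p] cong[of "monic_assoc p"] le[of "monic_assoc p"] monic_assoc(5)[OF p]
        by (simp add: N_def of_nat_diff)
    next
      case False
      have "\<not> p dvd h" if "pderiv p \<noteq> 0"
        using False that monic_assoc[OF p] dvd_trans[of "monic_assoc p" p h]
        by (auto simp: N_def separable_factors_def)
      then show ?thesis
        using coprime_log_deriv_multiplicity[OF p _ g eig] mult_g mult_f[OF p] False
        by (cases "pderiv p = 0") auto
    qed
  qed
  then show "pderiv (g div f) = 0" by (simp add: c_def)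
qed

lemma eigen_polys_common_factor:
  fixes h t :: "'a::field poly" and g :: "nat \<Rightarrow> 'a poly"
  assumes h: "h \<noteq> 0" and eig: "\<And>j. h * pderiv (g j) = t * g j" and gn: "g n \<noteq> 0"
  obtains \<beta> :: "'a poly \<Rightarrow> nat" where "\<And>u. 0 < CHAR('a) \<Longrightarrow> \<beta> u < CHAR('a)"
    and "\<And>j. (\<Prod>u\<in>separable_factors h. u ^ \<beta> u) dvd g j"
    and "\<And>j. pderiv (g j div (\<Prod>u\<in>separable_factors h. u ^ \<beta> u)) = 0"
proof
  define \<beta> where "\<beta> u = field_poly.multiplicity u (g n) mod CHAR('a)" for u
  show "\<beta> u < CHAR('a)" if "0 < CHAR('a)" for u using that by (simp add: \<beta>_def)
  fix j
  have cong: "of_nat (field_poly.multiplicity u (g j)) = (of_nat (\<beta> u) :: 'a)"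
    and le: "\<beta> u \<le> field_poly.multiplicity u (g j)"
    if u: "u \<in> separable_factors h" and gj: "g j \<noteq> 0" for u
  proof -
    have "prime_elem u" "pderiv u \<noteq> 0"
      using u by (simp_all add: separable_factors_def field_poly.prime_elem_iff_irreducible)
    from eigen_multiplicity_cong[OF h eig gj gn this]
    show "of_nat (field_poly.multiplicity u (g j)) = (of_nat (\<beta> u) :: 'a)"
      by (simp add: \<beta>_def of_nat_eq_iff_cong_CHAR cong_def)
    then have "field_poly.multiplicity u (g j) mod CHAR('a) = \<beta> u"
      by (simp add: \<beta>_def of_nat_eq_iff_cong_CHAR cong_def)
    then show "\<beta> u \<le> field_poly.multiplicity u (g j)" by (metis mod_less_eq_dividend)
  qed
  show "(\<Prod>u\<in>separable_factors h. u ^ \<beta> u) dvd g j"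
    using eigen_poly_factor(1)[OF h eig _ le cong] by (cases "g j = 0") auto
  show "pderiv (g j div (\<Prod>u\<in>separable_factors h. u ^ \<beta> u)) = 0"
    using eigen_poly_factor(2)[OF h eig _ le cong] by (cases "g j = 0") auto
qed

end

section \<open>The forward direction and the main theorem\<close>

lemma normal_move:
  "Anormal h v \<Longrightarrow> \<exists>a. Amult h v c = Amult h a v"
  unfolding Anormal_def by blast

text \<open>A normal element commutes with \<open>F[x]\<close>: \<open>v g = a v\<close> forces \<open>a = g\<close> by comparing degrees
  and leading coefficients in \<open>y\<close>.\<close>
lemma normal_commutes_with_Aemb:
  assumes v: "Anormal h v"
  shows "Amult h v (Aemb g) = Amult h (Aemb g) v"
proof (cases "v = 0 \<or> g = 0")
  case False
  then have nz: "v \<noteq> 0" "Aemb g \<noteq> 0" by (auto simp: Aemb_def)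
  obtain a where a: "Amult h v (Aemb g) = Amult h a v" using normal_move[OF v] by blast
  then have "a \<noteq> 0" using Amult_nonzero[OF nz] by auto
  with a Amult_degree[OF nz, of h] Amult_degree[OF _ nz(1), of a h]
  have "degree a = 0" "lead_coeff a * lead_coeff v = g * lead_coeff v"
    by (auto simp: Aemb_def mult.commute)
  then have "a = Aemb g" using nz(1) degree_0_id[of a] by (simp add: Aemb_def)
  then show ?thesis using a by simp
qed (auto simp: Aemb_def)

text \<open>For a normal \<open>v\<close>, degree considerations give \<open>v y = (y + s) v\<close> for some \<open>s \<in> F[x]\<close>, i.e.
  \<open>D\<^sub>h(v) = -s v\<close>: every coefficient \<open>g\<close> of \<open>v\<close> satisfies \<open>h g' = t g\<close> with \<open>t = -s\<close>.\<close>
lemma normal_coeffs_eigen: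
  assumes v: "Anormal h v"
  obtains t where "\<And>j. h * pderiv (coeff v j) = t * coeff v j"
proof (cases "v = 0")
  case False
  obtain b where b: "pCons 0 v = Amult h b v"
    using normal_move[OF v, of Y] by (auto simp: Amult_Y_right)
  then have "b \<noteq> 0" using False by auto
  note deg = Amult_degree[OF this False, of h, folded b]
  then have deg_b: "degree b = 1" using False by simp
  then have lead_b: "coeff b 1 = 1" using deg False by simp
  define t where "t = coeff b 0"
  have "b = Y + Aemb t"
  proof (rule poly_eqI)
    fix n :: nat
    consider "n = 0" | "n = 1" | "n > 1" by linarith
    then show "coeff b n = coeff (Y + Aemb t) n"
      by cases (use deg_b lead_b in \<open>simp_all add: t_def Y_def Aemb_def coeff_eq_0\<close>)
  qed
  with b have "pCons 0 v = ymul h v + smult t v"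
    by (simp add: Amult_Y_right Amult_add_left Amult_Y_left Amult_Aemb_left)
  then have "map_poly (Dh h) v + smult t v = 0" by (simp add: ymul_def)
  have "h * pderiv (coeff v j) = - t * coeff v j" for j
  proof -
    have "Dh h (coeff v j) + t * coeff v j = 0"
      using arg_cong[OF \<open>map_poly (Dh h) v + smult t v = 0\<close>, of "\<lambda>p. coeff p j"]
      by (simp add: coeff_map_poly)
    then show ?thesis by (simp add: Dh_def eq_neg_iff_add_eq_0)
  qed
  then show ?thesis by (rule that)
qed (auto intro: that[of 0])

lemma normal_imp_factorization:
  fixes h :: "'a::field poly"
  assumes h: "h \<noteq> 0" and v: "Anormal h v"
  obtains \<beta> z where "\<And>u. 0 < CHAR('a) \<Longrightarrow> \<beta> u < CHAR('a)" "z \<in> Acenter h"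
    "v = Amult h (Aemb (\<Prod>u\<in>separable_factors h. u ^ \<beta> u)) z"
proof (cases "v = 0")
  case True
  have "0 \<in> Acenter h" by (simp add: Acenter_def)
  with True show ?thesis by (intro that[of "\<lambda>_. 0"]) auto
next
  case False
  obtain t where eig: "\<And>j. h * pderiv (coeff v j) = t * coeff v j"
    using normal_coeffs_eigen[OF v] by blast
  obtain \<beta> where \<beta>: "\<And>u. 0 < CHAR('a) \<Longrightarrow> \<beta> u < CHAR('a)"
    and dvd: "\<And>j. (\<Prod>u\<in>separable_factors h. u ^ \<beta> u) dvd coeff v j"
    and deriv: "\<And>j. pderiv (coeff v j div (\<Prod>u\<in>separable_factors h. u ^ \<beta> u)) = 0"
    using eigen_polys_common_factor[where g = "coeff v" and n = "degree v", OF h eig] False by auto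
  define f where "f = (\<Prod>u\<in>separable_factors h. u ^ \<beta> u)"
  define z where "z = map_poly (\<lambda>q. q div f) v"
  have coeff_z: "coeff z j = coeff v j div f" for j by (simp add: z_def coeff_map_poly)
  have f_nz: "f \<noteq> 0" using dvd[of "degree v"] False by (auto simp: f_def)
  have v_eq: "v = Amult h (Aemb f) z"
    unfolding Amult_Aemb_left using dvd by (intro poly_eqI) (simp add: coeff_z f_def)
  have "z \<in> Acenter h"
  proof (rule central_if_commutes_with_generators)
    fix g
    have "smult f (Amult h z (Aemb g)) = Amult h (Aemb g) v"
      using normal_commutes_with_Aemb[OF v, of g] v_eq
      by (simp add: Amult_Aemb_left Amult_smult_left)
    also have "\<dots> = smult f (Amult h (Aemb g) z)"
      by (simp add: v_eq Amult_Aemb_left mult.commute)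
    finally show "Amult h z (Aemb g) = Amult h (Aemb g) z" by (rule smult_cancel[OF f_nz])
  next
    have "map_poly (Dh h) z = 0"
      by (intro poly_eqI) (simp add: coeff_map_poly coeff_z Dh_def deriv f_def)
    then show "Amult h z Y = Amult h Y z" by (simp add: commutes_Y_iff)
  qed
  with \<beta> v_eq show ?thesis unfolding f_def by (intro that)
qed

theorem theorem7p2:
  fixes h :: "'a::field poly"
  assumes "h \<noteq> 0"
  shows "(\<forall>v. Anormal h v \<longleftrightarrow>
            (\<exists>\<beta>::'a poly \<Rightarrow> nat. \<exists>z \<in> Acenter h.
               v = Amult h (Aemb (\<Prod>u\<in>noncentral_factors h. u ^ \<beta> u)) z))
       \<and> (CHAR('a) > 0 \<longrightarrow>
          (\<forall>v. Anormal h v \<longleftrightarrow>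
            (\<exists>\<beta>::'a poly \<Rightarrow> nat. \<exists>z \<in> Acenter h.
               (\<forall>u\<in>noncentral_factors h. \<beta> u < CHAR('a)) \<and>
               v = Amult h (Aemb (\<Prod>u\<in>noncentral_factors h. u ^ \<beta> u)) z)))"
proof -
  have factors: "noncentral_factors h = separable_factors h"
    using assms by (rule noncentral_factors_eq)
  have backward: "Anormal h (Amult h (Aemb (\<Prod>u\<in>noncentral_factors h. u ^ \<beta> u)) z)"
    if "z \<in> Acenter h" for \<beta> z
    by (rule normal_Aemb_mult_central[OF Dh_stable_prod that]) (simp add: noncentral_factors_def)
  have forward: "\<exists>\<beta>. \<exists>z \<in> Acenter h. (\<forall>u. 0 < CHAR('a) \<longrightarrow> \<beta> u < CHAR('a)) \<and>
      v = Amult h (Aemb (\<Prod>u\<in>noncentral_factors h. u ^ \<beta> u)) z"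
    if "Anormal h v" for v
    using normal_imp_factorization[OF assms that] unfolding factors by blast
  show ?thesis using backward forward by blast
qed

end
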